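(* Let $G$ be a graph. A set $X\subseteq V(G)$ is a partial monopoly if and only if $X$ is a global $(\mathbb{Z},\{o\in\mathbb{Z} : o\geq 1\})$-alliance.
   Context: Graphs are finite and simple. For a graph $G=(V,E)$, $S\subseteq V$ and $v\in V$, $N_S(v)$ is the set of neighbors of $v$ lying in $S$, $\delta_S(v)=|N_S(v)|$, $\overline{S}=V\setminus S$, $N[v]=N_V(v)\cup\{v\}$, $N(S)=\bigcup_{u\in S}N_V(u)$ and $N[S]=N(S)\cup S$. A set $S$ is dominating if $N[S]=V$. For $D,O\subseteq\mathbb{Z}$, a $(D,O)$-alliance in $G$ is a vertex set $S$ such that (1) $\delta_S(v)-\delta_{\overline{S}}(v)\in D$ for all $v\in S$, and (2) $\delta_S(v)-\delta_{\overline{S}}(v)\in O$ for all $v\in N(S)\setminus S$. It is called global if $S$ is also a dominating set. A partial monopoly in $G$ is a vertex set $X$ such that $|N[v]\cap X|\geq \frac{1}{2}|N[v]|$ for all $v\notin X$. *)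

theory Defs
  imports Complex_Main "Graph_Theory.Pair_Digraph"
begin

text \<open>
  A finite simple graph is a \<^locale>\<open>pair_graph\<close>: finitely many vertices and a symmetric,
  irreflexive arc relation. The vertices \<open>u\<close> and \<open>v\<close> are adjacent iff \<open>(u, v) \<in> parcs G\<close>.
\<close>

definition nbhd_in :: "'a pair_pre_digraph \<Rightarrow> 'a set \<Rightarrow> 'a \<Rightarrow> 'a set" where
  "nbhd_in G S v = {u \<in> S. (v, u) \<in> parcs G}"

definition deg_in :: "'a pair_pre_digraph \<Rightarrow> 'a set \<Rightarrow> 'a \<Rightarrow> nat" where
  "deg_in G S v = card (nbhd_in G S v)"

definition closed_nbhd :: "'a pair_pre_digraph \<Rightarrow> 'a \<Rightarrow> 'a set" where
  "closed_nbhd G v = nbhd_in G (pverts G) v \<union> {v}"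

definition set_nbhd :: "'a pair_pre_digraph \<Rightarrow> 'a set \<Rightarrow> 'a set" where
  "set_nbhd G S = (\<Union>u\<in>S. nbhd_in G (pverts G) u)"

definition closed_set_nbhd :: "'a pair_pre_digraph \<Rightarrow> 'a set \<Rightarrow> 'a set" where
  "closed_set_nbhd G S = set_nbhd G S \<union> S"

definition dominating_set :: "'a pair_pre_digraph \<Rightarrow> 'a set \<Rightarrow> bool" where
  "dominating_set G S \<longleftrightarrow> S \<subseteq> pverts G \<and> closed_set_nbhd G S = pverts G"

definition deg_diff :: "'a pair_pre_digraph \<Rightarrow> 'a set \<Rightarrow> 'a \<Rightarrow> int" where
  "deg_diff G S v = int (deg_in G S v) - int (deg_in G (pverts G - S) v)"

definition alliance :: "int set \<Rightarrow> int set \<Rightarrow> 'a pair_pre_digraph \<Rightarrow> 'a set \<Rightarrow> bool" where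
  "alliance D Q G S \<longleftrightarrow> S \<subseteq> pverts G
     \<and> (\<forall>v\<in>S. deg_diff G S v \<in> D)
     \<and> (\<forall>v\<in>set_nbhd G S - S. deg_diff G S v \<in> Q)"

definition global_alliance :: "int set \<Rightarrow> int set \<Rightarrow> 'a pair_pre_digraph \<Rightarrow> 'a set \<Rightarrow> bool" where
  "global_alliance D Q G S \<longleftrightarrow> alliance D Q G S \<and> dominating_set G S"

definition partial_monopoly :: "'a pair_pre_digraph \<Rightarrow> 'a set \<Rightarrow> bool" where
  "partial_monopoly G X \<longleftrightarrow> X \<subseteq> pverts G
     \<and> (\<forall>v\<in>pverts G - X. real (card (closed_nbhd G v \<inter> X)) \<ge> 1 / 2 * real (card (closed_nbhd G v)))"

end

theory Submission
  imports Defs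
begin

text \<open>
  For a vertex \<open>v\<close> outside \<open>X\<close> put \<open>a = \<delta>\<^sub>X(v)\<close> and \<open>b = \<delta>\<^sub>Y(v)\<close>, where \<open>Y\<close> is the complement
  of \<open>X\<close>. As \<open>v\<close> lies outside \<open>X\<close> and is not its own neighbour, \<open>X\<close> contains \<open>a\<close> of the
  \<open>a + b + 1\<close> elements of \<open>N[v]\<close>. The monopoly condition \<open>2a \<ge> a + b + 1\<close> is therefore the
  alliance condition \<open>a - b \<ge> 1\<close> (\<open>half_closed_nbhd_iff\<close>).
  The two notions impose this condition on different sets of vertices: all vertices outside \<open>X\<close>,
  respectively those outside \<open>X\<close> that have a neighbour in \<open>X\<close>. If \<open>X\<close> is dominating, these are
  the same vertices; and \<open>a - b \<ge> 1\<close> forces \<open>a \<ge> 1\<close>, so a partial monopoly is dominating.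
\<close>

lemma set_nbhd_subset: "set_nbhd G S \<subseteq> pverts G"
  by (auto simp: set_nbhd_def nbhd_in_def)

lemma set_nbhd_iff_deg_in_pos:
  assumes "pair_graph G" "X \<subseteq> pverts G" "v \<in> pverts G"
  shows "v \<in> set_nbhd G X \<longleftrightarrow> deg_in G X v > 0"
proof -
  interpret pair_graph G by fact
  have "finite (nbhd_in G X v)"
    using assms(2) by (auto simp: nbhd_in_def intro: finite_subset)
  moreover have "v \<in> set_nbhd G X \<longleftrightarrow> nbhd_in G X v \<noteq> {}"
    using assms(3) by (auto simp: set_nbhd_def nbhd_in_def dest: arcs_symmetric)
  ultimately show ?thesis
    by (simp add: deg_in_def card_gt_0_iff)
qed

lemma half_closed_nbhd_iff:
  assumes "pair_graph G" "X \<subseteq> pverts G" "v \<in> pverts G - X"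
  shows "real (card (closed_nbhd G v \<inter> X)) \<ge> 1 / 2 * real (card (closed_nbhd G v))
    \<longleftrightarrow> deg_diff G X v \<ge> 1"
proof -
  interpret pair_graph G by fact
  let ?A = "nbhd_in G X v" and ?B = "nbhd_in G (pverts G - X) v"
  have fin: "finite ?A" "finite ?B"
    using assms(2) by (auto simp: nbhd_in_def intro: finite_subset)
  have "closed_nbhd G v \<inter> X = ?A"
    using assms(2,3) by (auto simp: closed_nbhd_def nbhd_in_def)
  moreover have "closed_nbhd G v = insert v (?A \<union> ?B)"
    using assms(2) by (auto simp: closed_nbhd_def nbhd_in_def)
  moreover have "v \<notin> ?A \<union> ?B"
    using no_loops by (fastforce simp: nbhd_in_def)
  moreover have "?A \<inter> ?B = {}"
    by (auto simp: nbhd_in_def)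
  ultimately have "card (closed_nbhd G v \<inter> X) = deg_in G X v"
    and "card (closed_nbhd G v) = deg_in G X v + deg_in G (pverts G - X) v + 1"
    using fin by (simp_all add: deg_in_def card_Un_disjoint)
  then show ?thesis
    by (auto simp: deg_diff_def)
qed

lemma partial_monopoly_iff_deg_diff:
  assumes "pair_graph G" "X \<subseteq> pverts G"
  shows "partial_monopoly G X \<longleftrightarrow> (\<forall>v\<in>pverts G - X. deg_diff G X v \<ge> 1)"
  unfolding partial_monopoly_def using assms(2) half_closed_nbhd_iff[OF assms] by blast

theorem proposition7:
  fixes G :: "'a pair_pre_digraph" and X :: "'a set"
  assumes "pair_graph G"
    and "X \<subseteq> pverts G"
  shows "partial_monopoly G X \<longleftrightarrow> global_alliance UNIV {q :: int. q \<ge> 1} G X"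
proof
  assume "partial_monopoly G X"
  then have diff: "deg_diff G X v \<ge> 1" if "v \<in> pverts G - X" for v
    using partial_monopoly_iff_deg_diff[OF assms] that by blast
  have "v \<in> set_nbhd G X" if "v \<in> pverts G - X" for v
    using diff[OF that] that by (simp add: set_nbhd_iff_deg_in_pos[OF assms] deg_diff_def)
  then have "dominating_set G X"
    using assms(2) set_nbhd_subset[of G X]
    by (auto simp: dominating_set_def closed_set_nbhd_def)
  moreover have "alliance UNIV {q. q \<ge> 1} G X"
    using assms(2) diff set_nbhd_subset[of G X] by (auto simp: alliance_def)
  ultimately show "global_alliance UNIV {q. q \<ge> 1} G X"
    by (simp add: global_alliance_def)
next
  assume "global_alliance UNIV {q. q \<ge> 1} G X"
  then have "\<forall>v\<in>set_nbhd G X - X. deg_diff G X v \<ge> 1" and "set_nbhd G X \<union> X = pverts G"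
    by (auto simp: global_alliance_def alliance_def dominating_set_def closed_set_nbhd_def)
  then show "partial_monopoly G X"
    using partial_monopoly_iff_deg_diff[OF assms] by blast
qed

end
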